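(* For any $t\in\mathbb{N}$ we have $$\prod_{n\ge1}\frac{1}{(1-q^n)(1+aq^n+q^{2n})}=q^{-\frac{t(t+1)}{2}}\sum_{m=t}^\infty \mathcal{U}_m(a;q)\sum_{\gamma=0}^{m-t}\binom{m}{\gamma}\binom{m-\gamma}{\lfloor\frac{m-\gamma-t}{2}\rfloor}(-a)^\gamma,$$ where for $m\in\mathbb{N}$ $$\mathcal{U}_m(a;q)=\sum_{1\le n_1<n_2<\cdots<n_m}\frac{q^{n_1+n_2+\cdots+n_m}}{(1+aq^{n_1}+q^{2n_1})(1+aq^{n_2}+q^{2n_2})\cdots(1+aq^{n_m}+q^{2n_m})}.$$
   Context: $\mathbb{N}=\{1,2,3,\ldots\}$. All expressions are regarded as formal power series in $q$, with $a$ a complex number (or an indeterminate). *)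

theory Defs
  imports "HOL-Analysis.Analysis" "HOL-Computational_Algebra.Computational_Algebra"
begin

text \<open>
  Coefficients are taken in an arbitrary field, with \<open>a\<close> an arbitrary element of it.  This covers
  a complex number \<open>a\<close> as well as an indeterminate \<open>a\<close> (the generator of a field of rational
  functions such as \<open>complex poly fract\<close>).  Infinite sums and products of power series
  refer to the \<open>q\<close>-adic metric of type \<open>fps\<close>.
\<close>

definition strict_seqs :: "nat \<Rightarrow> nat list set" where
  "strict_seqs m = {ns. length ns = m \<and> (\<forall>n\<in>set ns. 1 \<le> n) \<and> sorted_wrt (<) ns}"

definition quad :: "'a::field \<Rightarrow> nat \<Rightarrow> 'a fps" where
  "quad a n = 1 + fps_const a * fps_X ^ n + fps_X ^ (2 * n)"

text \<open>Named separately so that summability of the family can be asserted: \<open>infsum\<close>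
  is \<open>0\<close> on families that are not summable.\<close>

definition U_term :: "'a::field \<Rightarrow> nat list \<Rightarrow> 'a fps" where
  "U_term a ns = fps_X ^ sum_list ns / (\<Prod>n\<leftarrow>ns. quad a n)"

definition U :: "nat \<Rightarrow> 'a::field \<Rightarrow> 'a fps" where
  "U m a = (\<Sum>\<^sub>\<infinity>ns\<in>strict_seqs m. U_term a ns)"

end

theory Submission
  imports Defs
begin

text \<open>
  The identity is the Jacobi triple product in disguise.  The product of
  \<open>1 + x q^n / (1 + a q^n + q^(2 n))\<close> over all \<open>n\<close> is the generating function of the
  \<open>U m a\<close>.  For \<open>x = - a - z - 1/z\<close> its numerators become \<open>(1 - z q^n) (1 - q^n / z)\<close>,
  so by the triple product
    \<open>(1 - z) \<Sum>m. U m a (- a - z - 1/z)^m = P \<Sum>k\<in>\<int>. (-1)^k q^(k (k - 1) / 2) z^k\<close>,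
  where \<open>P\<close> is the product of the theorem.  Comparing the coefficients of \<open>z^(- t)\<close> gives
  the theorem: on the right this coefficient is \<open>(-1)^t q^(t (t + 1) / 2) P\<close>, and on the left
  the coefficient of \<open>z^(- t)\<close> in \<open>(-1)^t (1 - z) (- a - z - 1/z)^m\<close> is the inner binomial
  sum.  The two binomial coefficients that the factor \<open>1 - z\<close> brings in live on opposite
  parities of \<open>m - \<gamma> - t\<close>, which is where the floor comes from.

  The proof never introduces \<open>z\<close>.  Multiplication by \<open>- a - z - 1/z\<close> acts on these
  coefficients as one step of a weighted walk on the natural numbers, so the inner sums are
  the numbers \<open>weighted_walks\<close>, governed by the recurrence \<open>weighted_walks_Suc\<close>.  With all
  summation indices restricted to \<open>1, \<dots>, N\<close>, the right-hand side becomes the finite sum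
  \<open>walk_sum a N t\<close>, and adding the index \<open>N + 1\<close> is again one step of a walk
  (\<open>walk_sum_Suc\<close>).  That recurrence in \<open>N\<close> is solved by Gaussian binomial coefficients
  (\<open>walk_sum_closed_form\<close>), the finite form of the triple product, and the theorem is the
  limit \<open>N \<rightarrow> \<infinity>\<close> in the \<open>q\<close>-adic topology.
\<close>

section \<open>Weighted walks\<close>

text \<open>
  The number of walks of length \<open>n\<close> from \<open>0\<close> to \<open>t\<close> on the natural numbers whose
  steps are \<open>+1\<close>, \<open>-1\<close>, and staying put at \<open>0\<close>; the two recurrences below split off the
  last step.
\<close>

definition refl_walks :: "nat \<Rightarrow> nat \<Rightarrow> nat" where
  "refl_walks n t = (if t \<le> n then n choose ((n - t) div 2) else 0)"

lemma refl_walks_0: "refl_walks 0 t = (if t = 0 then 1 else 0)"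
  by (simp add: refl_walks_def)

lemma refl_walks_gt: "n < t \<Longrightarrow> refl_walks n t = 0"
  by (simp add: refl_walks_def)

lemma refl_walks_Suc_0: "refl_walks (Suc n) 0 = refl_walks n 0 + refl_walks n 1"
proof (cases "n = 0")
  case False
  show ?thesis
  proof (cases "even n")
    case True
    then obtain k where k: "n = 2 * k" by (elim evenE)
    with False obtain j where j: "k = Suc j" by (cases k) auto
    have "(Suc (2 * j)) div 2 = j" by simp
    then show ?thesis using k j
      using binomial_symmetric[of "Suc j" "Suc (2 * Suc j)"] by (simp add: refl_walks_def)
  next
    case False
    then obtain k where k: "n = 2 * k + 1" by (elim oddE)
    have "(Suc (2 * k) choose k) = (Suc (2 * k) choose Suc k)"
      using binomial_symmetric[of k "Suc (2 * k)"] by simp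
    then show ?thesis using k by (simp add: refl_walks_def)
  qed
qed (simp add: refl_walks_def)

lemma refl_walks_Suc_Suc:
  "refl_walks (Suc n) (Suc t) = refl_walks n t + refl_walks n (Suc (Suc t))"
proof (cases "t \<le> n")
  case True
  then obtain d where d: "n = t + d" using le_Suc_ex by blast
  consider "d = 0" | "d = 1" | e where "d = Suc (Suc e)"
    by (metis One_nat_def not0_implies_Suc)
  then show ?thesis
    by cases (simp_all add: refl_walks_def d)
qed (simp add: refl_walks_def)

text \<open>
  The total weight of such walks when every vertex carries an additional loop of weight
  \<open>c\<close>: \<open>\<gamma>\<close> counts the uses of these loops.  Equivalently, this is \<open>(-1)^t\<close> times the
  coefficient of \<open>z^(- t)\<close> in \<open>(1 - z) (c - z - 1/z)^m\<close>.
\<close>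
definition weighted_walks :: "'b::comm_semiring_1 \<Rightarrow> nat \<Rightarrow> nat \<Rightarrow> 'b" where
  "weighted_walks c m t =
     (\<Sum>\<gamma>\<le>m. of_nat (m choose \<gamma>) * of_nat (refl_walks (m - \<gamma>) t) * c ^ \<gamma>)"

lemma weighted_walks_0: "weighted_walks c 0 t = (if t = 0 then 1 else 0)"
  by (simp add: weighted_walks_def refl_walks_0)

lemma weighted_walks_gt: "m < t \<Longrightarrow> weighted_walks c m t = 0"
  by (simp add: weighted_walks_def refl_walks_gt)

lemma weighted_walks_eq:
  assumes "t \<le> m"
  shows "weighted_walks c m t = (\<Sum>\<gamma> = 0..m - t. of_nat (m choose \<gamma>) *
           of_nat ((m - \<gamma>) choose ((m - \<gamma> - t) div 2)) * c ^ \<gamma>)"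
proof -
  have "weighted_walks c m t =
     (\<Sum>\<gamma> = 0..m - t. of_nat (m choose \<gamma>) * of_nat (refl_walks (m - \<gamma>) t) * c ^ \<gamma>)"
    unfolding weighted_walks_def
    using assms by (intro sum.mono_neutral_right) (auto simp: refl_walks_gt)
  also have "\<dots> = (\<Sum>\<gamma> = 0..m - t. of_nat (m choose \<gamma>) *
           of_nat ((m - \<gamma>) choose ((m - \<gamma> - t) div 2)) * c ^ \<gamma>)"
    using assms by (intro sum.cong) (auto simp: refl_walks_def)
  finally show ?thesis .
qed

text \<open>
  Pascal's rule for \<open>Suc m choose \<gamma>\<close>: the last step is either a weighted loop or an ordinary step.
\<close>
lemma weighted_walks_Suc_aux:
  "weighted_walks c (Suc m) t = c * weighted_walks c m t +
     (\<Sum>\<gamma>\<le>m. of_nat (m choose \<gamma>) * of_nat (refl_walks (Suc (m - \<gamma>)) t) * c ^ \<gamma>)"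
proof -
  define f where "f \<gamma> = of_nat (refl_walks (Suc m - \<gamma>) t) * c ^ \<gamma>" for \<gamma>
  have "weighted_walks c (Suc m) t = (\<Sum>\<gamma>\<le>Suc m. of_nat (Suc m choose \<gamma>) * f \<gamma>)"
    by (simp add: weighted_walks_def f_def mult.assoc)
  also have "\<dots> = f 0 + (\<Sum>\<gamma>\<le>m. of_nat (m choose \<gamma>) * f (Suc \<gamma>) + of_nat (m choose Suc \<gamma>) * f (Suc \<gamma>))"
    by (subst sum.atMost_Suc_shift) (simp add: distrib_right)
  also have "\<dots> = (\<Sum>\<gamma>\<le>m. of_nat (m choose \<gamma>) * f (Suc \<gamma>)) +
                    (f 0 + (\<Sum>\<gamma>\<le>m. of_nat (m choose Suc \<gamma>) * f (Suc \<gamma>)))"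
    by (simp add: sum.distrib add_ac)
  also have "f 0 + (\<Sum>\<gamma>\<le>m. of_nat (m choose Suc \<gamma>) * f (Suc \<gamma>)) =
             (\<Sum>\<gamma>\<le>Suc m. of_nat (m choose \<gamma>) * f \<gamma>)"
    by (subst sum.atMost_Suc_shift) simp
  also have "\<dots> = (\<Sum>\<gamma>\<le>m. of_nat (m choose \<gamma>) * f \<gamma>)"
    by (simp add: binomial_eq_0)
  also have "\<dots> = (\<Sum>\<gamma>\<le>m. of_nat (m choose \<gamma>) * of_nat (refl_walks (Suc (m - \<gamma>)) t) * c ^ \<gamma>)"
    by (intro sum.cong) (auto simp: f_def Suc_diff_le mult.assoc)
  also have "(\<Sum>\<gamma>\<le>m. of_nat (m choose \<gamma>) * f (Suc \<gamma>)) = c * weighted_walks c m t"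
    by (simp add: weighted_walks_def f_def sum_distrib_left mult_ac)
  finally show ?thesis .
qed

text \<open>
  At \<open>t = 0\<close> the truncated subtraction makes \<open>t - 1\<close> equal to \<open>0\<close>, which is what the unweighted
  loop at \<open>0\<close> requires: the factor \<open>1 - z\<close> makes the coefficients symmetric under
  \<open>t \<mapsto> - 1 - t\<close>, so that the value at \<open>- 1\<close> is the value at \<open>0\<close>.
\<close>
lemma weighted_walks_Suc:
  "weighted_walks c (Suc m) t = c * weighted_walks c m t +
     (weighted_walks c m (t - 1) + weighted_walks c m (Suc t))"
proof (cases t)
  case 0
  then show ?thesis
    unfolding weighted_walks_Suc_aux
    by (simp add: refl_walks_Suc_0 weighted_walks_def sum.distrib[symmetric] algebra_simps)
next
  case (Suc s)
  then show ?thesis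
    unfolding weighted_walks_Suc_aux
    by (simp add: refl_walks_Suc_Suc weighted_walks_def sum.distrib[symmetric] algebra_simps)
qed

section \<open>Truncating the sum over increasing sequences\<close>

text \<open>
  Restricting the indices to \<open>1, \<dots>, N\<close> makes \<open>U m a\<close> a finite sum, the \<open>m\<close>-th elementary
  symmetric polynomial in the first \<open>N\<close> weights \<open>q^n / (1 + a q^n + q^(2 n))\<close>.
\<close>
definition strict_seqs_upto :: "nat \<Rightarrow> nat \<Rightarrow> nat list set" where
  "strict_seqs_upto m N = {ns \<in> strict_seqs m. set ns \<subseteq> {..N}}"

definition U_upto :: "'a::field \<Rightarrow> nat \<Rightarrow> nat \<Rightarrow> 'a fps" where
  "U_upto a m N = (\<Sum>ns\<in>strict_seqs_upto m N. U_term a ns)"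

lemma finite_strict_seqs_upto [simp]: "finite (strict_seqs_upto m N)"
  by (rule finite_subset[OF _ finite_lists_length_eq[of "{..N}" m]])
     (auto simp: strict_seqs_upto_def strict_seqs_def)

lemma sorted_wrt_less_distinct: "sorted_wrt (<) (ns :: nat list) \<Longrightarrow> distinct ns"
  by (induction ns) auto

lemma U_upto_gt: "N < m \<Longrightarrow> U_upto a m N = 0"
proof -
  assume "N < m"
  have "length ns \<le> N" if "ns \<in> strict_seqs_upto m N" for ns
  proof -
    have "distinct ns" "set ns \<subseteq> {1..N}"
      using that by (auto simp: strict_seqs_upto_def strict_seqs_def sorted_wrt_less_distinct)
    then show ?thesis
      using card_mono[of "{1..N}" "set ns"] by (simp add: distinct_card)
  qed
  then have "strict_seqs_upto m N = {}"
    using \<open>N < m\<close> by (fastforce simp: strict_seqs_upto_def strict_seqs_def)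
  then show ?thesis by (simp add: U_upto_def)
qed

lemma U_upto_0: "U_upto a 0 N = 1"
proof -
  have "strict_seqs_upto 0 N = {[]}"
    by (auto simp: strict_seqs_upto_def strict_seqs_def)
  then show ?thesis by (simp add: U_upto_def U_term_def)
qed

lemma quad_nth_0 [simp]: "n > 0 \<Longrightarrow> fps_nth (quad a n) 0 = 1"
  by (simp add: quad_def fps_X_power_iff)

lemma prod_quad_nth_0 [simp]:
  assumes "\<forall>n\<in>set ns. 1 \<le> n"
  shows "fps_nth (\<Prod>n\<leftarrow>ns. quad a n) 0 = 1"
  using assms by (induction ns) auto

lemma U_term_snoc:
  assumes "\<forall>n\<in>set ns. 1 \<le> n" "n > 0"
  shows "U_term a (ns @ [n]) = U_term a ns * (fps_X ^ n / quad a n)"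
  using assms
  by (simp add: U_term_def fps_divide_unit fps_inverse_mult power_add mult_ac)

lemma strict_seqs_upto_Suc:
  "strict_seqs_upto (Suc m) (Suc N) =
     strict_seqs_upto (Suc m) N \<union> (\<lambda>ns. ns @ [Suc N]) ` strict_seqs_upto m N"
proof (intro equalityI subsetI)
  fix ns assume ns: "ns \<in> strict_seqs_upto (Suc m) (Suc N)"
  then obtain ms n where [simp]: "ns = ms @ [n]"
    by (cases ns rule: rev_cases) (auto simp: strict_seqs_upto_def strict_seqs_def)
  have *: "length ms = m" "\<forall>k\<in>set ms. 1 \<le> k \<and> k < n" "sorted_wrt (<) ms" "1 \<le> n" "n \<le> Suc N"
    using ns by (auto simp: strict_seqs_upto_def strict_seqs_def sorted_wrt_append)
  show "ns \<in> strict_seqs_upto (Suc m) N \<union> (\<lambda>ns. ns @ [Suc N]) ` strict_seqs_upto m N"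
  proof (cases "n = Suc N")
    case True
    then have "ms \<in> strict_seqs_upto m N"
      using * by (auto simp: strict_seqs_upto_def strict_seqs_def)
    then show ?thesis using True by auto
  next
    case False
    then have "ns \<in> strict_seqs_upto (Suc m) N"
      using * by (fastforce simp: strict_seqs_upto_def strict_seqs_def sorted_wrt_append)
    then show ?thesis by blast
  qed
next
  fix ns assume "ns \<in> strict_seqs_upto (Suc m) N \<union> (\<lambda>ns. ns @ [Suc N]) ` strict_seqs_upto m N"
  then show "ns \<in> strict_seqs_upto (Suc m) (Suc N)"
    by (fastforce simp: strict_seqs_upto_def strict_seqs_def sorted_wrt_append)
qed

lemma U_upto_Suc:
  "U_upto a (Suc m) (Suc N) =
     U_upto a (Suc m) N + fps_X ^ Suc N / quad a (Suc N) * U_upto a m N"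
proof -
  have "strict_seqs_upto (Suc m) N \<inter> (\<lambda>ns. ns @ [Suc N]) ` strict_seqs_upto m N = {}"
    by (auto simp: strict_seqs_upto_def)
  then have "U_upto a (Suc m) (Suc N) = U_upto a (Suc m) N +
               (\<Sum>ns\<in>(\<lambda>ns. ns @ [Suc N]) ` strict_seqs_upto m N. U_term a ns)"
    unfolding U_upto_def strict_seqs_upto_Suc by (intro sum.union_disjoint) auto
  also have "(\<Sum>ns\<in>(\<lambda>ns. ns @ [Suc N]) ` strict_seqs_upto m N. U_term a ns) =
               (\<Sum>ns\<in>strict_seqs_upto m N. U_term a (ns @ [Suc N]))"
    by (subst sum.reindex) (auto simp: inj_on_def)
  also have "\<dots> = (\<Sum>ns\<in>strict_seqs_upto m N. fps_X ^ Suc N / quad a (Suc N) * U_term a ns)"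
    by (intro sum.cong refl, subst U_term_snoc)
       (auto simp: strict_seqs_upto_def strict_seqs_def mult_ac)
  also have "\<dots> = fps_X ^ Suc N / quad a (Suc N) * U_upto a m N"
    by (simp add: U_upto_def sum_distrib_left)
  finally show ?thesis .
qed

lemma U_term_nth_eq_0:
  assumes "\<forall>n\<in>set ns. 1 \<le> n" "k < sum_list ns"
  shows "fps_nth (U_term a ns) k = 0"
  using assms by (simp add: U_term_def fps_divide_unit fps_X_power_mult_nth)

lemma length_le_sum_list: "\<forall>n\<in>set ns. (1::nat) \<le> n \<Longrightarrow> length ns \<le> sum_list ns"
  by (induction ns) auto

text \<open>
  The term of \<open>ns\<close> is divisible by \<open>q^(sum_list ns)\<close>, and the sum bounds both every entry and
  the length.  So only finitely many terms reach a given coefficient, which yields summability,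
  the agreement of \<open>U\<close> with its truncations, and the vanishing of low coefficients.
\<close>
lemma U_term_nth_support:
  assumes "ns \<in> strict_seqs m" "fps_nth (U_term a ns) k \<noteq> 0" "k \<le> N"
  shows "ns \<in> strict_seqs_upto m N" "m \<le> k"
proof -
  have pos: "\<forall>n\<in>set ns. 1 \<le> n" and len: "length ns = m"
    using assms(1) by (auto simp: strict_seqs_def)
  have le: "sum_list ns \<le> k"
    using U_term_nth_eq_0[OF pos] assms(2) by (meson not_le)
  have "n \<le> N" if "n \<in> set ns" for n
    using member_le_sum_list[OF that] le assms(3) by linarith
  then show "ns \<in> strict_seqs_upto m N"
    using assms(1) by (auto simp: strict_seqs_upto_def)
  show "m \<le> k"
    using length_le_sum_list[OF pos] le len by linarith
qed

lemma U_term_summable: "U_term a summable_on strict_seqs m"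
proof -
  have "finite {ns \<in> strict_seqs m. fps_nth (U_term a ns) k \<noteq> 0}" for k
    by (rule finite_subset[OF _ finite_strict_seqs_upto[of m k]])
       (auto intro: U_term_nth_support)
  then have "(U_term a has_sum Abs_fps (\<lambda>k. \<Sum>ns | ns \<in> strict_seqs m \<and>
               fps_nth (U_term a ns) k \<noteq> 0. fps_nth (U_term a ns) k)) (strict_seqs m)"
    by (intro has_sum_fpsI) auto
  then show ?thesis by (auto simp: summable_on_def)
qed

lemma U_nth_eq_U_upto_nth:
  assumes "k \<le> N"
  shows "fps_nth (U m a) k = fps_nth (U_upto a m N) k"
proof -
  have "(U_term a has_sum U m a) (strict_seqs m)"
    unfolding U_def using U_term_summable by (rule has_sum_infsum)
  from has_sum_fpsD(2)[OF this]
  have "fps_nth (U m a) k = (\<Sum>ns | ns \<in> strict_seqs m \<and> fps_nth (U_term a ns) k \<noteq> 0.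
          fps_nth (U_term a ns) k)" .
  also have "\<dots> = (\<Sum>ns\<in>strict_seqs_upto m N. fps_nth (U_term a ns) k)"
    using U_term_nth_support(1)[OF _ _ assms]
    by (intro sum.mono_neutral_left finite_strict_seqs_upto) (auto simp: strict_seqs_upto_def)
  also have "\<dots> = fps_nth (U_upto a m N) k"
    by (simp add: U_upto_def fps_sum_nth)
  finally show ?thesis .
qed

lemma U_upto_nth_eq_0:
  assumes "k < m"
  shows "fps_nth (U_upto a m N) k = 0"
proof -
  have "fps_nth (U_term a ns) k = 0" if "ns \<in> strict_seqs_upto m N" for ns
    using U_term_nth_support(2)[of ns m a k k] that assms
    by (auto simp: strict_seqs_upto_def)
  then show ?thesis by (simp add: U_upto_def fps_sum_nth)
qed

lemma U_nth_eq_0: "k < m \<Longrightarrow> fps_nth (U m a) k = 0"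
  using U_nth_eq_U_upto_nth[of k k m a] U_upto_nth_eq_0[of k m a k] by simp

section \<open>The finite identity\<close>

definition walk_sum :: "'a::field \<Rightarrow> nat \<Rightarrow> nat \<Rightarrow> 'a fps" where
  "walk_sum a N t = (\<Sum>m\<le>N. U_upto a m N * weighted_walks (fps_const (- a)) m t)"

text \<open>
  Adding the index \<open>n = N + 1\<close> contributes a factor \<open>1 + x q^n / quad a n\<close>, in which \<open>x\<close> acts
  by one step of the walk.  Clearing the denominator, the loops of weight \<open>- a\<close> cancel the linear
  term of \<open>quad a n\<close>; what is left is the effect of the factor
  \<open>(1 - z q^n) (1 - q^n / z)\<close>.
\<close>
lemma walk_sum_Suc:
  "quad a (Suc N) * walk_sum a (Suc N) t =
     (1 + fps_X ^ (2 * Suc N)) * walk_sum a N t +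
     fps_X ^ Suc N * (walk_sum a N (t - 1) + walk_sum a N (Suc t))"
proof -
  define W where "W = weighted_walks (fps_const (- a))"
  define v where "v = fps_X ^ Suc N / quad a (Suc N)"
  have qv: "quad a (Suc N) * v = fps_X ^ Suc N"
    by (simp add: v_def fps_divide_unit mult.left_commute inverse_mult_eq_1')
  have "walk_sum a (Suc N) t =
          W 0 t + (\<Sum>m\<le>N. U_upto a (Suc m) (Suc N) * W (Suc m) t)"
    unfolding walk_sum_def W_def[symmetric] by (subst sum.atMost_Suc_shift) (simp add: U_upto_0)
  also have "\<dots> = (U_upto a 0 N * W 0 t + (\<Sum>m\<le>N. U_upto a (Suc m) N * W (Suc m) t)) +
                    v * (\<Sum>m\<le>N. U_upto a m N * W (Suc m) t)"
    unfolding U_upto_Suc U_upto_0 v_def[symmetric]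
    by (simp add: sum.distrib sum_distrib_left algebra_simps)
  also have "U_upto a 0 N * W 0 t + (\<Sum>m\<le>N. U_upto a (Suc m) N * W (Suc m) t) =
               (\<Sum>m\<le>Suc N. U_upto a m N * W m t)"
    by (subst sum.atMost_Suc_shift) simp
  also have "\<dots> = walk_sum a N t"
    by (simp add: walk_sum_def W_def U_upto_gt)
  also have "(\<Sum>m\<le>N. U_upto a m N * W (Suc m) t) =
               fps_const (- a) * walk_sum a N t + (walk_sum a N (t - 1) + walk_sum a N (Suc t))"
    unfolding walk_sum_def W_def weighted_walks_Suc
    by (simp add: sum.distrib sum_distrib_left algebra_simps)
  finally have "quad a (Suc N) * walk_sum a (Suc N) t = quad a (Suc N) * walk_sum a N t +
      (quad a (Suc N) * v) *
      (fps_const (- a) * walk_sum a N t + (walk_sum a N (t - 1) + walk_sum a N (Suc t)))"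
    by (simp add: algebra_simps)
  also have "\<dots> = (quad a (Suc N) + fps_const (- a) * fps_X ^ Suc N) * walk_sum a N t +
                   fps_X ^ Suc N * (walk_sum a N (t - 1) + walk_sum a N (Suc t))"
    unfolding qv by (simp only: algebra_simps)
  also have "quad a (Suc N) + fps_const (- a) * fps_X ^ Suc N = 1 + fps_X ^ (2 * Suc N)"
    by (simp add: quad_def fps_const_neg[symmetric] del: fps_const_neg power_Suc)
  finally show ?thesis .
qed

lemma walk_sum_gt: "N < t \<Longrightarrow> walk_sum a N t = 0"
  by (simp add: walk_sum_def weighted_walks_gt)

text \<open>The \<open>q\<close>-Pochhammer symbol \<open>(q; q)\<^sub>N\<close>.\<close>
definition qfac :: "nat \<Rightarrow> 'a::field fps" where
  "qfac N = (\<Prod>i<N. 1 - fps_X ^ Suc i)"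

definition quad_prod :: "'a::field \<Rightarrow> nat \<Rightarrow> 'a fps" where
  "quad_prod a N = (\<Prod>i<N. quad a (Suc i))"

lemma qfac_Suc: "qfac (Suc N) = qfac N * (1 - fps_X ^ Suc N)"
  by (simp add: qfac_def)

lemma quad_prod_Suc: "quad_prod a (Suc N) = quad_prod a N * quad a (Suc N)"
  by (simp add: quad_prod_def)

text \<open>
  What the induction step of the closed form amounts to after the common factors are
  divided out, with \<open>u = q^t\<close> and \<open>v = q^(N + 1 - t)\<close>.
\<close>
lemma gauss_step_identity:
  fixes q u v :: "'b::comm_ring_1"
  shows "(1 + (u * v)^2) * ((1 - v) * (1 - q * u^2 * v)) +
         v * ((1 - u^2 * v) * (1 - q * u^2 * v)) + u^2 * v * ((q - v) * (1 - v)) =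
         (1 - (u * v)^2) * (1 - q * (u * v)^2)"
  by (simp add: algebra_simps power2_eq_square)

text \<open>
  The finite Jacobi triple product: \<open>walk_sum a N t\<close> times the product of the \<open>quad a n\<close> is
  \<open>q^(t (t + 1) / 2)\<close> times the Gaussian binomial coefficient of \<open>2 N + 1\<close> over \<open>N - t\<close>.
  In the induction on \<open>N\<close> each of the three terms of \<open>walk_sum_Suc\<close> is evaluated against the
  common denominator \<open>D\<close>; the outermost terms, where a neighbour lies outside \<open>0, \<dots>, N\<close>,
  fit the same formulas because a factor of the claimed value vanishes there, or, for
  \<open>t = 0\<close>, because the lower neighbour is \<open>0\<close> itself.
\<close>
lemma walk_sum_closed_form:
  assumes "t \<le> N"
  shows "walk_sum a N t * quad_prod a N * (qfac (N - t) * qfac (N + t + 1)) =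
           fps_X ^ (t * (t + 1) div 2) * qfac (2 * N + 1)"
  using assms
proof (induction N arbitrary: t)
  case 0
  then show ?case
    by (simp add: walk_sum_def U_upto_0 weighted_walks_0 quad_prod_def qfac_def)
next
  case (Suc N)
  define T where "T s = s * (s + 1) div 2" for s :: nat
  define C where "C s = walk_sum a N s * quad_prod a N" for s
  have T_Suc: "T (Suc s) = T s + Suc s" for s
    by (simp add: T_def)
  define e where "e = Suc N - t"
  have N: "Suc N = t + e" using Suc.prems by (simp add: e_def)
  define D :: "'a fps" where "D = qfac e * qfac (N + t + 2)"
  define u v q :: "'a fps" where "u = fps_X ^ t" and "v = fps_X ^ e" and "q = fps_X"
  have IH: "C s * (qfac (N - s) * qfac (N + s + 1)) = q ^ T s * qfac (2 * N + 1)"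
    if "s \<le> N" for s
    using Suc.IH[OF that] by (simp add: C_def T_def q_def)
  have Cgt: "C s = 0" if "N < s" for s
    using that by (simp add: C_def walk_sum_gt)
  have e1: "fps_X ^ Suc (N + t + 1) = q * u^2 * v"
  proof -
    have "Suc (N + t + 1) = 1 + 2 * t + e" using N by simp
    then show ?thesis by (simp only: power_add power_mult u_def v_def q_def) (simp add: power_mult[symmetric] mult.commute)
  qed
  have e2: "fps_X ^ Suc (N + t) = u^2 * v"
  proof -
    have "Suc (N + t) = 2 * t + e" using N by simp
    then show ?thesis by (simp only: power_add u_def v_def) (simp add: power_mult[symmetric] mult.commute)
  qed
  have middle: "C t * D = q ^ T t * qfac (2 * N + 1) * ((1 - v) * (1 - q * u^2 * v))"
  proof (cases "t \<le> N")
    case True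
    then have "e = Suc (N - t)" using N by simp
    then have "D = qfac (N - t) * (1 - v) * (qfac (N + t + 1) * (1 - q * u^2 * v))"
      using qfac_Suc[of "N - t", where 'a = 'a] qfac_Suc[of "N + t + 1", where 'a = 'a] e1
      by (simp add: D_def v_def)
    then have "C t * D = C t * (qfac (N - t) * qfac (N + t + 1)) * ((1 - v) * (1 - q * u^2 * v))"
      by (simp only: mult_ac)
    then show ?thesis by (simp only: IH[OF True])
  next
    case False
    then have "e = 0" using Suc.prems by (simp add: e_def)
    then have "v = 1" by (simp add: v_def)
    then show ?thesis using False by (simp add: Cgt)
  qed
  have lower: "q ^ Suc N * C (t - 1) * D =
      q ^ T t * qfac (2 * N + 1) * (v * ((1 - u^2 * v) * (1 - q * u^2 * v)))"
  proof (cases t)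
    case 0
    then have 1: "e = Suc N" "u = 1" using N by (auto simp: u_def)
    have "D = qfac (N - 0) * qfac (N + 0 + 1) * ((1 - u^2 * v) * (1 - q * u^2 * v))"
      using qfac_Suc[of N, where 'a = 'a] qfac_Suc[of "N + 1", where 'a = 'a] e1 e2 0 1
      by (simp add: D_def)
    then have "q ^ Suc N * C (t - 1) * D = q ^ Suc N * (C 0 * (qfac (N - 0) * qfac (N + 0 + 1))) *
      ((1 - u^2 * v) * (1 - q * u^2 * v))"
      using 0 by (simp only: mult_ac) simp
    then show ?thesis
      unfolding IH[OF le0] using 0 1 by (simp add: q_def v_def mult_ac)
  next
    case (Suc s)
    then have s: "s \<le> N" "e = N - s" using N by auto
    have "D = qfac (N - s) * qfac (N + s + 1) * ((1 - u^2 * v) * (1 - q * u^2 * v))"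
      using qfac_Suc[of "N + t", where 'a = 'a] qfac_Suc[of "N + t + 1", where 'a = 'a] e1 e2 s Suc
      by (simp add: D_def mult_ac)
    then have "q ^ Suc N * C (t - 1) * D = q ^ Suc N * (C s * (qfac (N - s) * qfac (N + s + 1))) *
      ((1 - u^2 * v) * (1 - q * u^2 * v))"
      using Suc by (simp only: mult_ac diff_Suc_1)
    also have "\<dots> = q ^ (Suc N + T s) * qfac (2 * N + 1) * ((1 - u^2 * v) * (1 - q * u^2 * v))"
      by (simp only: IH[OF s(1)] power_add mult_ac)
    also have "Suc N + T s = T t + e" using N Suc T_Suc[of s] by simp
    finally show ?thesis by (simp only: power_add q_def v_def mult_ac)
  qed
  have upper: "q ^ Suc N * C (Suc t) * D =
      q ^ T t * qfac (2 * N + 1) * (u^2 * v * ((q - v) * (1 - v)))"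
  proof (cases "Suc t \<le> N")
    case True
    \<comment> \<open>\<open>w = v / q\<close>; its factor \<open>1 - w\<close> appears as \<open>q - v\<close>, so that no division is needed at \<open>v = 1\<close>\<close>
    define w :: "'a fps" where "w = fps_X ^ (N - t)"
    have e: "e = Suc (N - t)" "N - t = Suc (N - Suc t)" using N True by auto
    have v: "v = q * w" by (simp add: v_def w_def q_def e(1))
    have "qfac e = qfac (N - Suc t) * (1 - w) * (1 - v)"
      using qfac_Suc[of "N - Suc t", where 'a = 'a] qfac_Suc[of "N - t", where 'a = 'a] e
      by (simp add: w_def v_def)
    then have "q ^ Suc N * C (Suc t) * D =
      q ^ Suc N * (C (Suc t) * (qfac (N - Suc t) * qfac (N + Suc t + 1))) * ((1 - w) * (1 - v))"
      by (simp add: D_def mult_ac)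
    also have "\<dots> = q ^ (Suc N + T (Suc t)) * qfac (2 * N + 1) * ((1 - w) * (1 - v))"
      by (simp only: IH[OF True] power_add mult_ac)
    also have "Suc N + T (Suc t) = T t + (2 * t + e + 1)" using N T_Suc[of t] by simp
    also have "q ^ \<dots> = q ^ T t * (u^2 * v * q)"
      by (simp only: power_add u_def v_def q_def) (simp add: power_mult[symmetric] mult.commute)
    finally show ?thesis unfolding v by (simp add: algebra_simps)
  next
    case False
    then have "e = 0 \<or> e = 1" using N by auto
    then have "v = 1 \<or> v = q" unfolding v_def q_def by (metis power_0 power_one_right)
    then have "(q - v) * (1 - v) = 0" by auto
    then show ?thesis using False by (simp add: Cgt)
  qed
  have A: "fps_X ^ (2 * Suc N) = (u * v)^2"
    unfolding u_def v_def N by (simp add: power_add power_mult[symmetric] power_mult_distrib mult.commute)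
  have "walk_sum a (Suc N) t * quad_prod a (Suc N) * (qfac (Suc N - t) * qfac (Suc N + t + 1)) =
          quad_prod a N * (quad a (Suc N) * walk_sum a (Suc N) t) * D"
    by (simp add: quad_prod_Suc D_def e_def mult_ac)
  also have "\<dots> = (1 + (u * v)^2) * (C t * D) + q ^ Suc N * C (t - 1) * D + q ^ Suc N * C (Suc t) * D"
    unfolding walk_sum_Suc C_def A q_def by (simp only: algebra_simps)
  also have "\<dots> = q ^ T t * qfac (2 * N + 1) *
     ((1 + (u * v)^2) * ((1 - v) * (1 - q * u^2 * v)) +
         v * ((1 - u^2 * v) * (1 - q * u^2 * v)) + u^2 * v * ((q - v) * (1 - v)))"
    unfolding middle lower upper by (simp only: algebra_simps)
  also have "\<dots> = q ^ T t * (qfac (2 * N + 1) * ((1 - (u * v)^2) * (1 - q * (u * v)^2)))"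
    unfolding gauss_step_identity by (simp only: mult_ac)
  also have "qfac (2 * N + 1) * ((1 - (u * v)^2) * (1 - q * (u * v)^2)) = qfac (2 * Suc N + 1)"
    using A qfac_Suc[of "2 * N + 1", where 'a = 'a] qfac_Suc[of "2 * N + 2", where 'a = 'a]
    by (simp add: q_def mult_ac)
  finally show ?case by (simp add: T_def q_def)
qed

section \<open>Limits of power series\<close>

lemma tendsto_mult_fps:
  fixes f g :: "'b \<Rightarrow> 'a::ring fps"
  assumes "(f \<longlongrightarrow> l) F" "(g \<longlongrightarrow> m) F"
  shows "((\<lambda>x. f x * g x) \<longlongrightarrow> l * m) F"
proof (rule tendsto_fpsI)
  fix n
  have "\<forall>\<^sub>F x in F. \<forall>k\<in>{..n}. fps_nth (f x) k = fps_nth l k \<and> fps_nth (g x) k = fps_nth m k"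
    using assms unfolding tendsto_fps_iff
    by (subst eventually_ball_finite_distrib) (auto intro: eventually_conj)
  then show "\<forall>\<^sub>F x in F. fps_nth (f x * g x) n = fps_nth (l * m) n"
    by eventually_elim (auto simp: fps_mult_nth intro!: sum.cong)
qed

text \<open>
  The factor \<open>f n\<close> is \<open>1\<close> modulo \<open>q^(n + 1)\<close>, so the \<open>k\<close>-th coefficient of the partial
  products no longer changes from \<open>N = k\<close> on.
\<close>
lemma prod_fps_convergent:
  fixes f :: "nat \<Rightarrow> 'a::comm_ring_1 fps"
  assumes "\<And>n k. k \<le> n \<Longrightarrow> fps_nth (f n) k = fps_nth 1 k"
  obtains P where "(\<lambda>N. \<Prod>i<N. f i) \<longlonglongrightarrow> P" "fps_nth P 0 = 1"
proof -
  have stable: "fps_nth (\<Prod>i<N. f i) k = fps_nth (\<Prod>i<k. f i) k" if "k \<le> N" for k N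
    using that
  proof (induction N rule: dec_induct)
    case (step N)
    have "fps_nth ((\<Prod>i<N. f i) * f N) k = fps_nth ((\<Prod>i<N. f i) * 1) k"
      unfolding fps_mult_nth using step.hyps assms by (intro sum.cong) auto
    then show ?case using step.IH by simp
  qed auto
  define P where "P = Abs_fps (\<lambda>k. fps_nth (\<Prod>i<k. f i) k)"
  have "(\<lambda>N. \<Prod>i<N. f i) \<longlonglongrightarrow> P"
  proof (rule tendsto_fpsI)
    fix k
    show "\<forall>\<^sub>F N in sequentially. fps_nth (\<Prod>i<N. f i) k = fps_nth P k"
      unfolding P_def fps_nth_Abs_fps using eventually_ge_at_top[of k]
      by eventually_elim (rule stable)
  qed
  then show ?thesis by (rule that) (simp add: P_def)
qed

text \<open>
  Terms with \<open>m > k\<close> do not reach the \<open>k\<close>-th coefficient, and for \<open>N \<ge> k\<close> the truncated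
  \<open>U_upto a m N\<close> has the right one; so each coefficient of \<open>walk_sum\<close> is eventually a
  constant finite sum.  Terms with \<open>m < t\<close> vanish, since a walk needs \<open>t\<close> steps to reach
  \<open>t\<close>.
\<close>
lemma walk_sum_tendsto:
  obtains S where "(\<lambda>N. walk_sum a N t) \<longlonglongrightarrow> S"
    "((\<lambda>m. U m a * weighted_walks (fps_const (- a)) m t) has_sum S) {t..}"
proof -
  define W where "W m = weighted_walks (fps_const (- a)) m t" for m
  have UW0: "fps_nth (U m a * W m) k = 0" if "k < m" for m k
    using that by (auto simp: fps_mult_nth U_nth_eq_0 intro!: sum.neutral)
  have UWN0: "fps_nth (U_upto a m N * W m) k = 0" if "k < m" for m k N
    using that by (auto simp: fps_mult_nth U_upto_nth_eq_0 intro!: sum.neutral)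
  define S where "S = Abs_fps (\<lambda>k. \<Sum>m\<le>k. fps_nth (U m a * W m) k)"
  have "(\<lambda>N. walk_sum a N t) \<longlonglongrightarrow> S"
  proof (rule tendsto_fpsI)
    fix k
    show "\<forall>\<^sub>F N in sequentially. fps_nth (walk_sum a N t) k = fps_nth S k"
      using eventually_ge_at_top[of k]
    proof eventually_elim
      case (elim N)
      have "fps_nth (walk_sum a N t) k = (\<Sum>m\<le>N. fps_nth (U_upto a m N * W m) k)"
        by (simp add: walk_sum_def W_def fps_sum_nth)
      also have "\<dots> = (\<Sum>m\<le>k. fps_nth (U_upto a m N * W m) k)"
        by (rule sum.mono_neutral_right) (use elim UWN0 in auto)
      also have "\<dots> = (\<Sum>m\<le>k. fps_nth (U m a * W m) k)"
        using elim by (intro sum.cong) (auto simp: fps_mult_nth U_nth_eq_U_upto_nth[of _ N])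
      finally show ?case by (simp add: S_def)
    qed
  qed
  moreover have "((\<lambda>m. U m a * W m) has_sum S) {t..}"
  proof (rule has_sum_fpsI)
    fix k
    have sub: "{m \<in> {t..}. fps_nth (U m a * W m) k \<noteq> 0} \<subseteq> {..k}"
    proof (intro subsetI, unfold atMost_iff, rule leI, rule notI)
      fix m assume "m \<in> {m \<in> {t..}. fps_nth (U m a * W m) k \<noteq> 0}" "k < m"
      then show False using UW0[of k m] by simp
    qed
    then show "finite {m \<in> {t..}. fps_nth (U m a * W m) k \<noteq> 0}"
      by (rule finite_subset) auto
    have "fps_nth S k = (\<Sum>m\<le>k. fps_nth (U m a * W m) k)"
      by (simp add: S_def)
    also have "\<dots> = (\<Sum>m | m \<in> {t..} \<and> fps_nth (U m a * W m) k \<noteq> 0. fps_nth (U m a * W m) k)"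
    proof (rule sum.mono_neutral_right[OF _ sub])
      have "W m = 0" if "m < t" for m
        using that by (simp add: W_def weighted_walks_gt)
      then show "\<forall>m\<in>{..k} - {m \<in> {t..}. fps_nth (U m a * W m) k \<noteq> 0}. fps_nth (U m a * W m) k = 0"
        by (metis (mono_tags, lifting) Diff_iff atLeast_iff fps_zero_nth mem_Collect_eq mult_zero_right not_le)
    qed simp
    finally show "fps_nth S k =
       (\<Sum>m | m \<in> {t..} \<and> fps_nth (U m a * W m) k \<noteq> 0. fps_nth (U m a * W m) k)" .
  qed
  ultimately show ?thesis unfolding W_def by (rule that)
qed

lemma quad_nth_le:
  assumes "k \<le> n"
  shows "fps_nth (quad a (Suc n)) k = fps_nth 1 k"
proof -
  have "k \<noteq> Suc n" "k \<noteq> 2 * Suc n" using assms by simp_all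
  then have "fps_nth (fps_X ^ Suc n :: 'a fps) k = 0" "fps_nth (fps_X ^ (2 * Suc n) :: 'a fps) k = 0"
    by (simp_all only: fps_X_power_nth if_False)
  then show ?thesis
    by (simp only: quad_def fps_add_nth fps_mult_left_const_nth mult_zero_right add_0_right)
qed

theorem theorem1p5:
  fixes a :: "'a::field" and t :: nat
  assumes "t \<ge> 1"
  defines "F \<equiv> \<lambda>n. 1 / ((1 - fps_X ^ n) * quad a n)"
    and "G \<equiv> \<lambda>m. U m a *
      (\<Sum>\<gamma> = 0..m - t. of_nat (m choose \<gamma>) * of_nat ((m - \<gamma>) choose ((m - \<gamma> - t) div 2))
        * fps_const ((- a) ^ \<gamma>))"
  shows "(\<forall>m\<ge>1. U_term a summable_on strict_seqs m)
    \<and> convergent_prod (\<lambda>n. F (Suc n))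
    \<and> G summable_on {t..}
    \<and> fps_to_fls (\<Prod>n. F (Suc n))
        = fls_X_intpow (- int (t * (t + 1) div 2)) * fps_to_fls (\<Sum>\<^sub>\<infinity>m\<in>{t..}. G m)"
proof -
  define T where "T = t * (t + 1) div 2"
  obtain E :: "'a fps" where E: "qfac \<longlonglongrightarrow> E" "fps_nth E 0 = 1"
    unfolding qfac_def by (rule prod_fps_convergent[of "\<lambda>i. 1 - fps_X ^ Suc i"])
      (auto simp: fps_X_power_iff simp del: power_Suc)
  obtain Q :: "'a fps" where Q: "quad_prod a \<longlonglongrightarrow> Q" "fps_nth Q 0 = 1"
    unfolding quad_prod_def by (rule prod_fps_convergent[of "\<lambda>i. quad a (Suc i)"])
      (auto simp: quad_nth_le)
  obtain S where S: "(\<lambda>N. walk_sum a N t) \<longlonglongrightarrow> S"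
    "((\<lambda>m. U m a * weighted_walks (fps_const (- a)) m t) has_sum S) {t..}"
    by (rule walk_sum_tendsto)
  have nz: "E \<noteq> 0" using E(2) by auto

  have prod_F: "(\<Prod>i<N. F (Suc i)) = inverse (qfac N * quad_prod a N)" for N
  proof (induction N)
    case (Suc N)
    have "F (Suc N) = inverse ((1 - fps_X ^ Suc N) * quad a (Suc N))"
      unfolding F_def by (subst fps_divide_unit) (auto simp: fps_X_power_iff)
    then show ?case
      using Suc by (simp add: qfac_Suc quad_prod_Suc fps_inverse_mult mult_ac)
  qed (simp add: qfac_def quad_prod_def)
  have "(\<lambda>N. \<Prod>i<N. F (Suc i)) \<longlonglongrightarrow> inverse (E * Q)"
    unfolding prod_F using E Q by (intro tendsto_inverse_fps tendsto_mult_fps) auto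
  then have raw: "raw_has_prod (\<lambda>n. F (Suc n)) 0 (inverse (E * Q))"
    using E(2) Q(2) by (simp add: raw_has_prod_def LIMSEQ_lessThan_iff_atMost)
  then have conv: "convergent_prod (\<lambda>n. F (Suc n))"
    unfolding convergent_prod_def by blast
  have "(\<lambda>n. F (Suc n)) has_prod inverse (E * Q)"
    using raw by (simp add: has_prod_def)
  then have prodinf: "(\<Prod>n. F (Suc n)) = inverse (E * Q)"
    by (rule has_prod_unique[symmetric])

  \<comment> \<open>The limit of the closed form; one of the two factors \<open>E\<close> cancels against the numerator.\<close>
  have "S * Q * (E * E) = fps_X ^ T * E"
  proof (rule LIMSEQ_unique)
    have qfac_lim: "(\<lambda>N. qfac (f N)) \<longlonglongrightarrow> E" if f: "\<And>N. N \<le> f N + t" for f :: "nat \<Rightarrow> nat"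
    proof (rule filterlim_compose[OF E(1)], unfold filterlim_at_top, intro allI)
      fix Z
      show "\<forall>\<^sub>F N in sequentially. Z \<le> f N"
        using eventually_ge_at_top[of "Z + t"]
      proof eventually_elim
        case (elim N)
        then show ?case using f[of N] by linarith
      qed
    qed
    show "(\<lambda>N. fps_X ^ T * qfac (2 * N + 1)) \<longlonglongrightarrow> fps_X ^ T * E"
      by (intro tendsto_mult_fps qfac_lim tendsto_const) simp
    have "(\<lambda>N. walk_sum a N t * quad_prod a N * (qfac (N - t) * qfac (N + t + 1))) \<longlonglongrightarrow>
            S * Q * (E * E)"
      by (intro tendsto_mult_fps qfac_lim S Q) simp_all
    moreover have "\<forall>\<^sub>F N in sequentially.
        walk_sum a N t * quad_prod a N * (qfac (N - t) * qfac (N + t + 1)) =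
        fps_X ^ T * qfac (2 * N + 1)"
      using eventually_ge_at_top[of t]
      by eventually_elim (simp only: walk_sum_closed_form T_def)
    ultimately show "(\<lambda>N. fps_X ^ T * qfac (2 * N + 1)) \<longlonglongrightarrow> S * Q * (E * E)"
      by (rule Lim_transform_eventually)
  qed
  then have "E * (S * (E * Q)) = E * fps_X ^ T" by (simp add: mult_ac)
  then have SEQ: "S * (E * Q) = fps_X ^ T" using nz by simp
  have "(E * Q) * inverse (E * Q) = 1"
    using E(2) Q(2) by (intro inverse_mult_eq_1') simp
  then have "S = S * (E * Q) * inverse (E * Q)"
    by (simp only: mult.assoc mult_1_right)
  then have S_eq: "S = fps_X ^ T * (\<Prod>n. F (Suc n))"
    by (simp add: SEQ prodinf)

  have "G m = U m a * weighted_walks (fps_const (- a)) m t" if "m \<in> {t..}" for m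
    using that unfolding G_def by (simp add: weighted_walks_eq fps_const_power)
  then have G: "(G has_sum S) {t..}"
    using S(2) by (subst has_sum_cong) auto
  have "fls_X_intpow (- int T) * fps_to_fls S =
          fls_X_intpow (- int T) * fls_X_intpow (int T) * fps_to_fls (\<Prod>n. F (Suc n))"
    unfolding S_eq fls_times_fps_to_fls fps_to_fls_power
    by (simp add: fls_X_power_conv_shift_1 mult.assoc)
  also have "\<dots> = fps_to_fls (\<Prod>n. F (Suc n))"
    by (simp only: fls_X_intpow_times_fls_X_intpow) simp
  finally show ?thesis
    using conv G U_term_summable by (auto simp: T_def infsumI summable_on_def)
qed

end
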